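(* Let $d\ge 1$ and let $\mathscr{F}_1,\ldots,\mathscr{F}_{d+2}$ be (possibly infinite) families of spheres in $\mathbb{R}^d$. If for every choice of spheres $S_i\in\mathscr{F}_i$, $1\le i\le d+2$, the intersection $\bigcap_{i=1}^{d+2}S_i$ is nonempty, then there is an index $i\in\{1,\ldots,d+2\}$ such that $\bigcap_{S\in\mathscr{F}_i}S\neq\emptyset$.
   Context: A sphere in $\mathbb{R}^d$ is a set of the form $\{x\in\mathbb{R}^d:\|x-c\|=r\}$ with $c\in\mathbb{R}^d$ and $r>0$, where $\|\cdot\|$ is the Euclidean norm (the paper calls these "$d$-dimensional spheres"). The intersection of an empty family is understood to be $\mathbb{R}^d$. *)

theory Defs
  imports "HOL-Analysis.Analysis"
begin

(* The library's sphere c r is also defined for r \<le> 0 (a point or the empty set);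
   these degenerate cases are excluded here. *)
definition is_sphere :: "(real ^ 'n) set \<Rightarrow> bool" where
  "is_sphere S \<longleftrightarrow> (\<exists>c r. r > 0 \<and> S = sphere c r)"

end

theory Submission
  imports Defs
begin

text \<open>
  Lift \<open>\<real>\<^sup>d\<close> to a paraboloid in \<open>\<real>\<^sup>d\<^sup>+\<^sup>1\<close> by \<open>x \<mapsto> (x, \<parallel>x\<parallel>\<^sup>2)\<close>. The equation
  \<open>\<parallel>x\<parallel>\<^sup>2 - 2 c \<bullet> x = r\<^sup>2 - \<parallel>c\<parallel>\<^sup>2\<close> of a sphere is affine in the lifted point, so spheres are preimages
  of hyperplanes (\<open>sphere_eq_vimage_hyperplane\<close>), and the theorem becomes a colourful Helly theorem
  for preimages of affine sets (\<open>colourful_Helly_affine_vimage\<close>).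

  Suppose no family has a common point, and choose \<open>S\<^sub>1, S\<^sub>2, \<dots>\<close> greedily. The intersection \<open>X\<close> of the
  sets chosen so far is nonempty, being part of a rainbow choice, and some member of
  the next family misses a given point of \<open>X\<close>; adding that member cuts \<open>X\<close> properly. Each proper cut lowers the
  dimension of the affine hull of the lift of \<open>X\<close> (\<open>aff_dim_image_cut_less\<close>). The dimension
  is at most \<open>d + 1\<close> at the start, hence after \<open>d + 2\<close> cuts it is negative: the \<open>d + 2\<close> chosen sets have
  empty intersection, contrary to the hypothesis.
\<close>

text \<open>The affine hull of the lifted cut stays inside \<open>A\<close>, while \<open>f x\<close> does not lie in \<open>A\<close>.\<close>

lemma aff_dim_image_cut_less:
  fixes f :: "'a \<Rightarrow> 'b::euclidean_space"
  assumes "affine A" "x \<in> X" "f x \<notin> A"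
  shows "aff_dim (f ` (X \<inter> f -` A)) < aff_dim (f ` X)"
proof (rule aff_dim_psubset)
  have "affine hull (f ` (X \<inter> f -` A)) \<subseteq> A"
    using assms(1) by (intro hull_minimal) auto
  moreover have "f x \<in> affine hull (f ` X)"
    using assms(2) by (simp add: hull_inc)
  moreover have "affine hull (f ` (X \<inter> f -` A)) \<subseteq> affine hull (f ` X)"
    by (intro hull_mono) auto
  ultimately show "affine hull (f ` (X \<inter> f -` A)) \<subset> affine hull (f ` X)"
    using assms(3) by blast
qed

lemma colourful_Helly_affine_vimage:
  fixes f :: "'a \<Rightarrow> 'b::euclidean_space" and F :: "nat \<Rightarrow> 'a set set"
  assumes m: "m = DIM('b) + 1"
    and vimage: "\<And>i S. i \<in> {1..m} \<Longrightarrow> S \<in> F i \<Longrightarrow> \<exists>A. affine A \<and> S = f -` A"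
    and rainbow: "\<And>S. (\<And>i. i \<in> {1..m} \<Longrightarrow> S i \<in> F i) \<Longrightarrow> (\<Inter>i\<in>{1..m}. S i) \<noteq> {}"
  shows "\<exists>i\<in>{1..m}. \<Inter>(F i) \<noteq> {}"
proof (rule ccontr)
  assume "\<not> ?thesis"
  then have empty: "\<Inter>(F i) = {}" if "i \<in> {1..m}" for i
    using that by blast
  \<comment> \<open>An empty family would have the whole space as its intersection.\<close>
  then have "\<exists>T. T \<in> F i" if "i \<in> {1..m}" for i
    using that by fastforce
  then obtain R where R: "R i \<in> F i" if "i \<in> {1..m}" for i
    by metis
  have greedy: "\<exists>S. (\<forall>i\<in>{1..k}. S i \<in> F i) \<and>
      aff_dim (f ` (\<Inter>i\<in>{1..k}. S i)) \<le> int (DIM('b)) - int k" if "k \<le> m" for k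
    using that
  proof (induction k)
    case 0
    then show ?case by (simp add: aff_dim_le_DIM)
  next
    case (Suc k)
    then have "k \<le> m"
      by simp
    from Suc.IH[OF this] obtain S where S: "\<forall>i\<in>{1..k}. S i \<in> F i"
      and dim: "aff_dim (f ` (\<Inter>i\<in>{1..k}. S i)) \<le> int (DIM('b)) - int k"
      by (elim exE conjE)
    define X where "X = (\<Inter>i\<in>{1..k}. S i)"
    \<comment> \<open>Completing the partial choice to a rainbow one shows that it has a common point.\<close>
    have "(\<Inter>i\<in>{1..m}. if i \<le> k then S i else R i) \<noteq> {}"
      using S R by (intro rainbow) auto
    then obtain x where x: "x \<in> (if i \<le> k then S i else R i)" if "i \<in> {1..m}" for i
      by blast
    have "x \<in> X"
      unfolding X_def
    proof (rule INT_I)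
      fix i assume "i \<in> {1..k}"
      then show "x \<in> S i"
        using x[of i] Suc.prems by simp
    qed
    from Suc.prems have k: "Suc k \<in> {1..m}"
      by simp
    then obtain T where T: "T \<in> F (Suc k)" "x \<notin> T"
      using empty by blast
    then obtain A where A: "affine A" "T = f -` A"
      using vimage k by blast
    have "aff_dim (f ` (X \<inter> T)) < aff_dim (f ` X)"
      using aff_dim_image_cut_less[OF A(1) \<open>x \<in> X\<close>] T(2) A(2) by simp
    then have "aff_dim (f ` (X \<inter> T)) \<le> int (DIM('b)) - int (Suc k)"
      using dim X_def by simp
    moreover have "(\<Inter>i\<in>{1..Suc k}. (S(Suc k := T)) i) = X \<inter> T"
      by (auto simp: X_def atLeastAtMostSuc_conv)
    moreover have "\<forall>i\<in>{1..Suc k}. (S(Suc k := T)) i \<in> F i"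
      using S T(1) by (auto simp: le_Suc_eq)
    ultimately show ?case
      by (intro exI[of _ "S(Suc k := T)"]) (simp only: simp_thms)
  qed
  obtain S where S: "\<forall>i\<in>{1..m}. S i \<in> F i"
    and "aff_dim (f ` (\<Inter>i\<in>{1..m}. S i)) \<le> int (DIM('b)) - int m"
    using greedy[of m] by blast
  then have "aff_dim (f ` (\<Inter>i\<in>{1..m}. S i)) < 0"
    unfolding m by linarith
  then have "(\<Inter>i\<in>{1..m}. S i) = {}"
    by (simp only: aff_dim_negative_iff image_is_empty)
  moreover have "(\<Inter>i\<in>{1..m}. S i) \<noteq> {}"
    using S by (intro rainbow) (rule bspec)
  ultimately show False
    by contradiction
qed

lemma sphere_eq_vimage_hyperplane:
  fixes c :: "'a::euclidean_space"
  assumes "r \<ge> 0"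
  shows "sphere c r =
    (\<lambda>x. (x, x \<bullet> x)) -` {z. (- 2 *\<^sub>R c, 1::real) \<bullet> z = r\<^sup>2 - c \<bullet> c}"
proof -
  have "dist c x = r \<longleftrightarrow> (c - x) \<bullet> (c - x) = r\<^sup>2" for x
    using assms by (simp add: dist_norm norm_eq_square)
  then show ?thesis
    by (auto simp: inner_diff inner_commute)
qed

theorem theorem2p1:
  fixes F :: "nat \<Rightarrow> (real ^ 'n) set set"
  assumes "\<And>i S. i \<in> {1..CARD('n) + 2} \<Longrightarrow> S \<in> F i \<Longrightarrow> is_sphere S"
    and "\<And>S. (\<And>i. i \<in> {1..CARD('n) + 2} \<Longrightarrow> S i \<in> F i) \<Longrightarrow> (\<Inter>i\<in>{1..CARD('n) + 2}. S i) \<noteq> {}"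
  shows "\<exists>i\<in>{1..CARD('n) + 2}. \<Inter>(F i) \<noteq> {}"
proof -
  have dim: "CARD('n) + 2 = DIM((real ^ 'n) \<times> real) + 1"
    by simp
  have vimage: "\<exists>A. affine A \<and> S = (\<lambda>x. (x, x \<bullet> x)) -` A"
    if "i \<in> {1..CARD('n) + 2}" "S \<in> F i" for i S
  proof -
    from that have "is_sphere S"
      by (rule assms(1))
    then obtain c r where "r > 0" "S = sphere c r"
      unfolding is_sphere_def by blast
    then have "affine {z. (- 2 *\<^sub>R c, 1) \<bullet> z = r\<^sup>2 - c \<bullet> c} \<and>
        S = (\<lambda>x. (x, x \<bullet> x)) -` {z. (- 2 *\<^sub>R c, 1) \<bullet> z = r\<^sup>2 - c \<bullet> c}"
      by (simp only: affine_hyperplane sphere_eq_vimage_hyperplane less_imp_le simp_thms)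
    then show ?thesis
      by (rule exI)
  qed
  show ?thesis
    by (rule colourful_Helly_affine_vimage[OF dim vimage assms(2)])
qed

end
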